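(* The universality problem (given an automaton $\mathcal{A}$ over an alphabet $\Sigma$, does $\mathcal{A}$ accept every infinite word in $\Sigma^\omega$?) is undecidable for deterministic reachability-regular Parikh automata and undecidable for deterministic weak reset Parikh automata.
   Context: $\mathbb{N}=\{0,1,2,\dots\}$. A linear set is a set $C(\mathbf{b},P)=\{\mathbf{b}+\mathbf{p}_1z_1+\dots+\mathbf{p}_\ell z_\ell \mid z_1,\dots,z_\ell\in\mathbb{N}\}\subseteq\mathbb{N}^d$ with $\mathbf{b}\in\mathbb{N}^d$ and $P=\{\mathbf{p}_1,\dots,\mathbf{p}_\ell\}\subseteq\mathbb{N}^d$ finite ($\ell\ge 0$); a semi-linear set is a finite union of linear sets, given explicitly by base and period vectors. A Parikh automaton (PA) of dimension $d\ge 1$ is a tuple $\mathcal{A}=(Q,\Sigma,q_0,\Delta,F,C)$ with a finite state set $Q$, a finite non-empty alphabet $\Sigma$, an initial state $q_0\in Q$, a finite set of labeled transitions $\Delta\subseteq Q\times\Sigma\times\mathbb{N}^d\times Q$, a set of accepting states $F\subseteq Q$, and a semi-linear set $C\subseteq\mathbb{N}^d$. It is deterministic if for every $(p,a)\in Q\times\Sigma$ there is exactly one transition $(p,a,\mathbf{v},q)\in\Delta$. A run on $\alpha=\alpha_1\alpha_2\dots\in\Sigma^\omega$ is an infinite sequence $r=r_1r_2\dots$ with $r_i=(p_{i-1},\alpha_i,\mathbf{v}_i,p_i)\in\Delta$ and $p_0=q_0$; write $\rho(r_m\dots r_n)=\sum_{i=m}^n\mathbf{v}_i$. An automaton accepts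 $\alpha$ if there is an accepting run on $\alpha$. Acceptance of a run $r$: - Reachability-regular PA: there is $i\ge 1$ with $p_i\in F$ and $\rho(r_1\dots r_i)\in C$, and there are infinitely many $j\ge 1$ with $p_j\in F$. - Weak reset PA: there are infinitely many positions $0=k_0<k_1<k_2<\dots$ such that $p_{k_i}\in F$ and $\rho(r_{k_{i-1}+1}\dots r_{k_i})\in C$ for all $i\ge 1$. *)

theory Defs
  imports Main "HOL-Library.Nat_Bijection"
begin

section \<open>Semi-linear sets\<close>

text \<open>
  A vector of dimension \<open>d\<close> over the natural numbers is a list of length \<open>d\<close>.
  The coefficients of a linear combination are given by a function on the period vectors.
\<close>

definition linear_set :: "nat \<Rightarrow> nat list \<Rightarrow> nat list set \<Rightarrow> nat list set" where
  "linear_set d b P = {map (\<lambda>j. b ! j + (\<Sum>p\<in>P. p ! j * z p)) [0..<d] | z :: nat list \<Rightarrow> nat. True}"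

definition generators :: "nat \<Rightarrow> (nat list \<times> nat list set) set \<Rightarrow> bool" where
  "generators d G \<longleftrightarrow>
     finite G \<and> (\<forall>(b, P)\<in>G. length b = d \<and> finite P \<and> (\<forall>p\<in>P. length p = d))"

definition semilinear_set :: "nat \<Rightarrow> (nat list \<times> nat list set) set \<Rightarrow> nat list set" where
  "semilinear_set d G = (\<Union>(b, P)\<in>G. linear_set d b P)"

definition semilinear :: "nat \<Rightarrow> nat list set \<Rightarrow> bool" where
  "semilinear d C \<longleftrightarrow> (\<exists>G. generators d G \<and> C = semilinear_set d G)"


section \<open>Parikh automata on infinite words\<close>

type_synonym ('q, 'a) transition = "'q \<times> 'a \<times> nat list \<times> 'q"

record ('q, 'a) parikh_automaton =
  dimension :: nat
  states :: "'q set"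
  alphabet :: "'a set"
  initial :: 'q
  transitions :: "('q, 'a) transition set"
  accepting :: "'q set"
  constraint :: "nat list set"

definition is_PA :: "('q, 'a) parikh_automaton \<Rightarrow> bool" where
  "is_PA A \<longleftrightarrow>
     dimension A \<ge> 1 \<and>
     finite (states A) \<and>
     finite (alphabet A) \<and> alphabet A \<noteq> {} \<and>
     initial A \<in> states A \<and>
     finite (transitions A) \<and>
     transitions A \<subseteq> states A \<times> alphabet A \<times> {v. length v = dimension A} \<times> states A \<and>
     accepting A \<subseteq> states A \<and>
     semilinear (dimension A) (constraint A)"

definition deterministic :: "('q, 'a) parikh_automaton \<Rightarrow> bool" where
  "deterministic A \<longleftrightarrow>
     (\<forall>p\<in>states A. \<forall>a\<in>alphabet A. \<exists>!t. t \<in> transitions A \<and> (\<exists>v q. t = (p, a, v, q)))"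

fun source :: "('q, 'a) transition \<Rightarrow> 'q" where
  "source (p, a, v, q) = p"

fun letter :: "('q, 'a) transition \<Rightarrow> 'a" where
  "letter (p, a, v, q) = a"

fun label :: "('q, 'a) transition \<Rightarrow> nat list" where
  "label (p, a, v, q) = v"

fun target :: "('q, 'a) transition \<Rightarrow> 'q" where
  "target (p, a, v, q) = q"

text \<open>
  Words and runs are indexed from 0: \<open>\<alpha> i\<close> and \<open>r i\<close> are the letter
  $\alpha_{i+1}$ and the transition $r_{i+1} = (p_i, \alpha_{i+1}, v_{i+1}, p_{i+1})$.
  Hence \<open>state_at r i\<close> is $p_i$, the state reached after \<open>i\<close> transitions, and
  \<open>rho A r m n\<close> is $\rho(r_{m+1} \dots r_n)$.
\<close>

definition is_run :: "('q, 'a) parikh_automaton \<Rightarrow> (nat \<Rightarrow> 'a) \<Rightarrow> (nat \<Rightarrow> ('q, 'a) transition) \<Rightarrow> bool"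
  where
  "is_run A \<alpha> r \<longleftrightarrow>
     source (r 0) = initial A \<and>
     (\<forall>i. r i \<in> transitions A \<and> letter (r i) = \<alpha> i \<and> target (r i) = source (r (Suc i)))"

definition state_at :: "(nat \<Rightarrow> ('q, 'a) transition) \<Rightarrow> nat \<Rightarrow> 'q" where
  "state_at r i = source (r i)"

definition rho ::
  "('q, 'a) parikh_automaton \<Rightarrow> (nat \<Rightarrow> ('q, 'a) transition) \<Rightarrow> nat \<Rightarrow> nat \<Rightarrow> nat list" where
  "rho A r m n = map (\<lambda>j. \<Sum>i\<in>{m..<n}. label (r i) ! j) [0..<dimension A]"

definition reach_reg_accepting ::
  "('q, 'a) parikh_automaton \<Rightarrow> (nat \<Rightarrow> ('q, 'a) transition) \<Rightarrow> bool" where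
  "reach_reg_accepting A r \<longleftrightarrow>
     (\<exists>i\<ge>1. state_at r i \<in> accepting A \<and> rho A r 0 i \<in> constraint A) \<and>
     infinite {j. j \<ge> 1 \<and> state_at r j \<in> accepting A}"

definition weak_reset_accepting ::
  "('q, 'a) parikh_automaton \<Rightarrow> (nat \<Rightarrow> ('q, 'a) transition) \<Rightarrow> bool" where
  "weak_reset_accepting A r \<longleftrightarrow>
     (\<exists>k :: nat \<Rightarrow> nat. k 0 = 0 \<and> strict_mono k \<and>
        (\<forall>i\<ge>1. state_at r (k i) \<in> accepting A \<and> rho A r (k (i - 1)) (k i) \<in> constraint A))"

definition accepts ::
  "(('q, 'a) parikh_automaton \<Rightarrow> (nat \<Rightarrow> ('q, 'a) transition) \<Rightarrow> bool) \<Rightarrow>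
   ('q, 'a) parikh_automaton \<Rightarrow> (nat \<Rightarrow> 'a) \<Rightarrow> bool" where
  "accepts acc A \<alpha> \<longleftrightarrow> (\<exists>r. is_run A \<alpha> r \<and> acc A r)"

definition universal ::
  "(('q, 'a) parikh_automaton \<Rightarrow> (nat \<Rightarrow> ('q, 'a) transition) \<Rightarrow> bool) \<Rightarrow>
   ('q, 'a) parikh_automaton \<Rightarrow> bool" where
  "universal acc A \<longleftrightarrow> (\<forall>\<alpha>. (\<forall>i. \<alpha> i \<in> alphabet A) \<longrightarrow> accepts acc A \<alpha>)"


section \<open>Partial recursive functions and decidability\<close>

text \<open>
  Kleene's partial recursive functions; \<open>None\<close> stands for divergence (or a wrong number
  of arguments). The recursion and search variable is the first argument, and a search diverges
  if some value before the first zero is undefined.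
\<close>

datatype recf =
  Zero
| Succ
| Proj nat
| Comp recf "recf list"
| PrimRec recf recf
| Mu recf

fun rec_eval :: "recf \<Rightarrow> nat list \<Rightarrow> nat option" where
  "rec_eval Zero xs = Some 0"
| "rec_eval Succ xs = (case xs of [x] \<Rightarrow> Some (Suc x) | _ \<Rightarrow> None)"
| "rec_eval (Proj i) xs = (if i < length xs then Some (xs ! i) else None)"
| "rec_eval (Comp f gs) xs =
     (let ys = map (\<lambda>g. rec_eval g xs) gs
      in if None \<in> set ys then None else rec_eval f (map the ys))"
| "rec_eval (PrimRec f g) xs =
     (case xs of
        [] \<Rightarrow> None
      | n # zs \<Rightarrow>
          rec_nat (rec_eval f zs)
            (\<lambda>m u. case u of None \<Rightarrow> None | Some y \<Rightarrow> rec_eval g (m # y # zs)) n)"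
| "rec_eval (Mu f) xs =
     (if \<exists>n. rec_eval f (n # xs) = Some 0 \<and> (\<forall>m<n. rec_eval f (m # xs) \<noteq> None)
      then Some (LEAST n. rec_eval f (n # xs) = Some 0)
      else None)"

text \<open>
  \<open>decidable_on code I P\<close>: there is an algorithm that, given the code of any instance in \<open>I\<close>,
  halts and answers correctly whether the instance satisfies \<open>P\<close>. Nothing is required of the
  algorithm on numbers that do not encode an instance.
\<close>

definition decidable_on :: "('i \<Rightarrow> nat) \<Rightarrow> 'i set \<Rightarrow> ('i \<Rightarrow> bool) \<Rightarrow> bool" where
  "decidable_on code I P \<longleftrightarrow>
     (\<exists>f. \<forall>x\<in>I. rec_eval f [code x] = Some (if P x then 1 else 0))"


section \<open>Parikh automata as inputs of algorithms\<close>

text \<open>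
  The finite description of an automaton: finite sets are listed, states and letters are
  named by natural numbers, and the semi-linear set is given by base and period vectors.
\<close>

record presentation =
  pdim :: nat
  pstates :: "nat list"
  palphabet :: "nat list"
  pinit :: nat
  ptrans :: "(nat, nat) transition list"
  pacc :: "nat list"
  pgens :: "(nat list \<times> nat list list) list"

definition gens_of :: "presentation \<Rightarrow> (nat list \<times> nat list set) set" where
  "gens_of D = (\<lambda>(b, ps). (b, set ps)) ` set (pgens D)"

definition automaton_of :: "presentation \<Rightarrow> (nat, nat) parikh_automaton" where
  "automaton_of D = \<lparr>
     dimension = pdim D,
     states = set (pstates D),
     alphabet = set (palphabet D),
     initial = pinit D,
     transitions = set (ptrans D),
     accepting = set (pacc D),
     constraint = semilinear_set (pdim D) (gens_of D)\<rparr>"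

definition presents_PA :: "presentation \<Rightarrow> bool" where
  "presents_PA D \<longleftrightarrow> generators (pdim D) (gens_of D) \<and> is_PA (automaton_of D)"

fun code_trans :: "(nat, nat) transition \<Rightarrow> nat" where
  "code_trans (p, a, v, q) = list_encode [p, a, list_encode v, q]"

fun code_gen :: "nat list \<times> nat list list \<Rightarrow> nat" where
  "code_gen (b, ps) = prod_encode (list_encode b, list_encode (map list_encode ps))"

definition code_PA :: "presentation \<Rightarrow> nat" where
  "code_PA D = list_encode
     [pdim D,
      list_encode (pstates D),
      list_encode (palphabet D),
      pinit D,
      list_encode (map code_trans (ptrans D)),
      list_encode (pacc D),
      list_encode (map code_gen (pgens D))]"

definition deterministic_PAs :: "presentation set" where
  "deterministic_PAs = {D. presents_PA D \<and> deterministic (automaton_of D)}"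

lemma inj_code_trans: "inj code_trans"
  by (rule injI) (auto elim!: code_trans.elims simp: list_encode_eq simp del: list_encode.simps)

lemma inj_code_gen: "inj code_gen"
proof (rule injI)
  have inj: "inj (list_encode :: nat list \<Rightarrow> nat)"
    by (simp add: inj_def list_encode_eq)
  fix x y assume "code_gen x = code_gen y"
  then show "x = y"
    by (cases x, cases y) (auto simp: list_encode_eq inj_map_eq_map[OF inj])
qed

lemma inj_code_PA: "inj code_PA"
  by (rule injI)
    (auto simp: code_PA_def list_encode_eq inj_map_eq_map[OF inj_code_trans]
      inj_map_eq_map[OF inj_code_gen] simp del: list_encode.simps intro: presentation.equality)

end

theory Submission
  imports Defs "HOL-Library.Countable"
begin

text \<open>
  A word is read as a sequence of guesses of the zero tests of a register program. The automaton
  counts increments and decrements, and its constraint consists of the vectors that witness a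
  wrong guess or the halting of the program. All states are accepting, so a word is rejected iff
  none of its prefixes is a witness, and such a word exists iff the program runs forever. For weak
  resets, the constraint also contains every vector of an infix that does not leave the initial
  state; after a first reset the automaton can therefore reset after every letter.

  Given a decider \<open>f\<close>, take a register program that computes \<open>f\<close> on the code of an automaton and
  halts iff the answer is "not universal". The code can be the one of the automaton of this very
  program: all its parts that depend on the program are numbers loaded into registers by the label
  of the transitions from the initial state, and they occur in no other label.
\<close>

section \<open>Compiling recursive functions to register programs\<close>

datatype instr = Inc nat | Loop nat "instr list"

instance instr :: countable
  by countable_datatype

type_synonym config = "instr list \<times> (nat \<Rightarrow> nat)"

text \<open>The code component is the whole remaining program instead of a program counter. Such
  lists will be states of the automaton and can be followed without the store. A halted
  configuration is a fixed point.\<close>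

fun step :: "config \<Rightarrow> config" where
  "step ([], s) = ([], s)"
| "step (Inc r # cs, s) = (cs, s(r := Suc (s r)))"
| "step (Loop r b # cs, s) =
     (if s r = 0 then (cs, s) else (b @ Loop r b # cs, s(r := s r - 1)))"

text \<open>Quantifying over the continuation \<open>cs\<close> lets terminating executions compose
  by adding their step counts.\<close>

definition runs :: "instr list \<Rightarrow> (nat \<Rightarrow> nat) \<Rightarrow> (nat \<Rightarrow> nat) \<Rightarrow> bool" where
  "runs p s s' \<longleftrightarrow> (\<forall>cs. \<exists>n. (step ^^ n) (p @ cs, s) = (cs, s'))"

lemma runs_Nil: "runs [] s s"
  unfolding runs_def by (intro allI exI[of _ 0]) simp

lemma runs_append:
  assumes "runs p s s'" "runs q s' s''"
  shows "runs (p @ q) s s''"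
  unfolding runs_def
proof
  fix cs
  obtain m where "(step ^^ m) (p @ (q @ cs), s) = (q @ cs, s')"
    using assms(1) unfolding runs_def by blast
  moreover obtain n where "(step ^^ n) (q @ cs, s') = (cs, s'')"
    using assms(2) unfolding runs_def by blast
  ultimately have "(step ^^ (n + m)) ((p @ q) @ cs, s) = (cs, s'')"
    by (simp add: funpow_add)
  then show "\<exists>n. (step ^^ n) ((p @ q) @ cs, s) = (cs, s'')" ..
qed

lemma runs_Cons: "runs [c] s s' \<Longrightarrow> runs p s' s'' \<Longrightarrow> runs (c # p) s s''"
  using runs_append[of "[c]"] by simp

lemma runs_Inc: "runs [Inc r] s (s(r := Suc (s r)))"
  unfolding runs_def by (intro allI exI[of _ 1]) simp

lemma runs_Loop_exit: "s r = 0 \<Longrightarrow> runs [Loop r b] s s"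
  unfolding runs_def by (intro allI exI[of _ 1]) simp

lemma runs_Loop_enter:
  assumes "s r \<noteq> 0" "runs b (s(r := s r - 1)) s'" "runs [Loop r b] s' s''"
  shows "runs [Loop r b] s s''"
  unfolding runs_def
proof
  fix cs
  obtain n where "(step ^^ n) ((b @ [Loop r b]) @ cs, s(r := s r - 1)) = (cs, s'')"
    using runs_append[OF assms(2,3)] unfolding runs_def by blast
  then have "(step ^^ Suc n) ([Loop r b] @ cs, s) = (cs, s'')"
    using assms(1) by (simp add: funpow_Suc_right del: funpow.simps)
  then show "\<exists>n. (step ^^ n) ([Loop r b] @ cs, s) = (cs, s'')" ..
qed

text \<open>\<open>\<sigma> i\<close> is the store before round \<open>i\<close>. Later loops are
  verified by giving this sequence in closed form.\<close>

lemma runs_Loop: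
  assumes "\<And>i. i < n \<Longrightarrow> \<sigma> i r \<noteq> 0"
    and "\<And>i. i < n \<Longrightarrow> runs b ((\<sigma> i)(r := \<sigma> i r - 1)) (\<sigma> (Suc i))"
    and "\<sigma> n r = 0"
  shows "runs [Loop r b] (\<sigma> 0) (\<sigma> n)"
  using assms
proof (induction n arbitrary: \<sigma>)
  case 0
  then show ?case by (simp add: runs_Loop_exit)
next
  case (Suc n)
  have "runs [Loop r b] (\<sigma> (Suc 0)) (\<sigma> (Suc n))"
    using Suc.IH[of "\<lambda>i. \<sigma> (Suc i)"] Suc.prems by simp
  then show ?case
    by (rule runs_Loop_enter[OF Suc.prems(1)[OF zero_less_Suc] Suc.prems(2)[OF zero_less_Suc]])
qed

lemma runs_clear: "runs [Loop r []] s (s(r := 0))"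
  using runs_Loop[of "s r" "\<lambda>i. s(r := s r - i)" r "[]"] by (simp add: runs_Nil)

lemma runs_clear_all: "runs (map (\<lambda>r. Loop r []) rs) s (\<lambda>r. if r \<in> set rs then 0 else s r)"
proof (induction rs arbitrary: s)
  case (Cons r rs)
  \<comment> \<open>As an elimination rule, \<open>back_subst\<close> leaves the equality of the two
    final stores, which is checked pointwise.\<close>
  from runs_Cons[OF runs_clear[of r s] Cons] show ?case
    by (auto elim!: back_subst[where P = "runs _ _"])
qed (simp add: runs_Nil)

lemma runs_move:
  assumes "r \<noteq> t"
  shows "runs [Loop r [Inc t]] s (s(r := 0, t := s t + s r))"
proof -
  let ?\<sigma> = "\<lambda>i. s(r := s r - i, t := s t + i)"
  have "runs [Inc t] ((?\<sigma> i)(r := ?\<sigma> i r - 1)) (?\<sigma> (Suc i))" for i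
    using runs_Inc[of t "(?\<sigma> i)(r := ?\<sigma> i r - 1)"] assms
    by (auto elim!: back_subst[where P = "runs _ _"])
  with runs_Loop[of "s r" ?\<sigma> r "[Inc t]"] assms show ?thesis by simp
qed

text \<open>Reading a register by a loop destroys it, so its value goes to \<open>b\<close> and
  \<open>t\<close> together and returns from \<open>t\<close>.\<close>

lemma runs_copy:
  assumes "a \<noteq> b" "a \<noteq> t" "b \<noteq> t" "s t = 0"
  shows "runs [Loop a [Inc b, Inc t], Loop t [Inc a]] s (s(b := s b + s a))"
proof -
  let ?\<sigma> = "\<lambda>i. s(a := s a - i, b := s b + i, t := i)"
  have "runs [Inc b, Inc t] ((?\<sigma> i)(a := ?\<sigma> i a - 1)) (?\<sigma> (Suc i))" for i
    using runs_Cons[OF runs_Inc[of b "(?\<sigma> i)(a := ?\<sigma> i a - 1)"] runs_Inc[of t]] assms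
    by (auto elim!: back_subst[where P = "runs _ _"])
  with runs_Loop[of "s a" ?\<sigma> a "[Inc b, Inc t]"] assms
  have "runs [Loop a [Inc b, Inc t]] s (?\<sigma> (s a))" by (simp add: fun_upd_idem)
  from runs_Cons[OF this runs_move[of t a]] assms show ?thesis
    by (auto elim!: back_subst[where P = "runs _ _"])
qed

text \<open>
  Registers from \<open>k\<close> on are scratch space. As all registers except \<open>out\<close> keep their
  values, the scratch registers are zero again at the end.
\<close>

definition implements :: "instr list \<Rightarrow> recf \<Rightarrow> nat list \<Rightarrow> nat \<Rightarrow> nat \<Rightarrow> bool" where
  "implements p f args out k \<longleftrightarrow>
     (\<forall>s y. (\<forall>r\<ge>k. s r = 0) \<longrightarrow> rec_eval f (map s args) = Some y \<longrightarrow>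
        runs p s (s(out := s out + y)))"

lemma implementsD:
  assumes "implements p f args out k" "\<And>r. k \<le> r \<Longrightarrow> s r = 0"
    "rec_eval f (map s args) = Some y" "s' = s(out := s out + y)"
  shows "runs p s s'"
  using assms unfolding implements_def by blast

section \<open>Compilation of each constructor of partial recursive functions\<close>

definition compilable :: "recf \<Rightarrow> bool" where
  "compilable f \<longleftrightarrow>
     (\<forall>args out k. (\<forall>r\<in>set args. r < k) \<longrightarrow> out < k \<longrightarrow> out \<notin> set args \<longrightarrow>
        (\<exists>p. implements p f args out k))"

lemma compilableD:
  assumes "compilable f" "\<And>r. r \<in> set args \<Longrightarrow> r < k" "out < k" "out \<notin> set args"
  shows "\<exists>p. implements p f args out k"
  using assms unfolding compilable_def by blast

text \<open>All values must be present at once before an outer function is applied, so they go to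
  consecutive registers from \<open>j\<close> on. Extending the list at its end puts each new output
  register and its scratch space above the earlier results.\<close>

lemma compilable_list:
  assumes "\<forall>g\<in>set gs. compilable g" "\<forall>r\<in>set args. r < k" "k \<le> j"
  shows "\<exists>p. \<forall>s ys. (\<forall>r\<ge>k. s r = 0) \<longrightarrow> length ys = length gs \<longrightarrow>
     (\<forall>i<length gs. rec_eval (gs ! i) (map s args) = Some (ys ! i)) \<longrightarrow>
     runs p s (\<lambda>r. if j \<le> r \<and> r < j + length gs then ys ! (r - j) else s r)"
  using assms
proof (induction gs rule: rev_induct)
  case Nil
  have "(\<lambda>r. if j \<le> r \<and> r < j + length [] then ys ! (r - j) else s r) = s" for s :: "nat \<Rightarrow> nat" and ys
    by auto
  then show ?case by (intro exI[of _ "[]"]) (auto simp: runs_Nil)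
next
  case (snoc g gs)
  obtain p where p: "\<forall>s ys. (\<forall>r\<ge>k. s r = 0) \<longrightarrow> length ys = length gs \<longrightarrow>
     (\<forall>i<length gs. rec_eval (gs ! i) (map s args) = Some (ys ! i)) \<longrightarrow>
     runs p s (\<lambda>r. if j \<le> r \<and> r < j + length gs then ys ! (r - j) else s r)"
    using snoc by auto
  let ?m = "j + length gs"
  have "\<exists>q. implements q g args ?m (Suc ?m)"
    by (rule compilableD) (use snoc.prems in fastforce)+
  then obtain q where q: "implements q g args ?m (Suc ?m)" ..
  show ?case
  proof (intro exI[of _ "p @ q"] allI impI)
    fix s :: "nat \<Rightarrow> nat" and ys :: "nat list"
    assume s: "\<forall>r\<ge>k. s r = 0" and len: "length ys = length (gs @ [g])"
      and ev: "\<forall>i<length (gs @ [g]). rec_eval ((gs @ [g]) ! i) (map s args) = Some (ys ! i)"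
    let ?s = "\<lambda>r. if j \<le> r \<and> r < ?m then ys ! (r - j) else s r"
    have args: "map ?s args = map s args" using snoc.prems by auto
    have 1: "runs p s ?s"
    proof -
      have "\<forall>i<length gs. rec_eval (gs ! i) (map s args) = Some (butlast ys ! i)"
        using ev len by (auto simp: nth_append nth_butlast split: if_splits)
      moreover have "(\<lambda>r. if j \<le> r \<and> r < ?m then butlast ys ! (r - j) else s r) = ?s"
        using len by (auto simp: nth_butlast fun_eq_iff)
      moreover have "length (butlast ys) = length gs" using len by simp
      ultimately show ?thesis using p[rule_format, of s "butlast ys"] s by simp
    qed
    have "rec_eval g (map s args) = Some (ys ! length gs)"
      using ev by (metis nth_append_length length_append_singleton lessI)
    then have "runs q ?s (?s(?m := ?s ?m + ys ! length gs))"
      using s snoc.prems by (intro implementsD[OF q]) (auto simp: args simp del: map_map)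
    moreover have "?s(?m := ?s ?m + ys ! length gs) =
        (\<lambda>r. if j \<le> r \<and> r < j + length (gs @ [g]) then ys ! (r - j) else s r)"
      using s snoc.prems by (auto simp: fun_eq_iff less_Suc_eq)
    ultimately show "runs (p @ q) s
        (\<lambda>r. if j \<le> r \<and> r < j + length (gs @ [g]) then ys ! (r - j) else s r)"
      using runs_append[OF 1] by simp
  qed
qed

lemma compilable_Zero: "compilable Zero"
  unfolding compilable_def implements_def by (auto intro!: exI[of _ "[]"] simp: runs_Nil)

lemma compilable_Proj: "compilable (Proj i)"
  unfolding compilable_def
proof (intro allI impI)
  fix args :: "nat list" and out k :: nat
  assume *: "\<forall>r\<in>set args. r < k" "out < k" "out \<notin> set args"
  \<comment> \<open>Register \<open>k\<close> is scratch space for restoring the argument. If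
    \<open>i\<close> is out of range, the value is undefined and nothing is claimed.\<close>
  have "implements [Loop (args ! i) [Inc out, Inc k], Loop k [Inc (args ! i)]] (Proj i) args out k"
    unfolding implements_def
  proof (intro allI impI)
    fix s :: "nat \<Rightarrow> nat" and y
    assume s: "\<forall>r\<ge>k. s r = 0" and "rec_eval (Proj i) (map s args) = Some y"
    then have i: "i < length args" and y: "y = s (args ! i)" by (auto split: if_splits)
    have "args ! i < k" "args ! i \<noteq> out" using * i nth_mem by blast+
    then show "runs [Loop (args ! i) [Inc out, Inc k], Loop k [Inc (args ! i)]] s (s(out := s out + y))"
      unfolding y using * s by (intro runs_copy) auto
  qed
  then show "\<exists>p. implements p (Proj i) args out k" ..
qed

lemma compilable_Succ: "compilable Succ"
  unfolding compilable_def
proof (intro allI impI)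
  fix args :: "nat list" and out k :: nat
  assume *: "\<forall>r\<in>set args. r < k" "out < k" "out \<notin> set args"
  then obtain p where p: "implements p (Proj 0) args out k"
    using compilable_Proj unfolding compilable_def by blast
  have "implements (p @ [Inc out]) Succ args out k"
    unfolding implements_def
  proof (intro allI impI)
    fix s :: "nat \<Rightarrow> nat" and y
    assume s: "\<forall>r\<ge>k. s r = 0" and "rec_eval Succ (map s args) = Some y"
    then obtain a where a: "args = [a]" "y = Suc (s a)" by (auto split: list.splits)
    have "runs p s (s(out := s out + s a))"
      using s a by (intro implementsD[OF p]) auto
    from runs_append[OF this runs_Inc[of out]] a show "runs (p @ [Inc out]) s (s(out := s out + y))"
      by simp
  qed
  then show "\<exists>p. implements p Succ args out k" ..
qed

lemma compilable_Comp:
  assumes f: "compilable f" and gs: "\<forall>g\<in>set gs. compilable g"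
  shows "compilable (Comp f gs)"
  unfolding compilable_def
proof (intro allI impI)
  fix args :: "nat list" and out k :: nat
  assume *: "\<forall>r\<in>set args. r < k" "out < k" "out \<notin> set args"
  let ?n = "length gs"
  let ?rs = "[k..<k + ?n]"
  obtain p where p: "\<forall>s ys. (\<forall>r\<ge>k. s r = 0) \<longrightarrow> length ys = ?n \<longrightarrow>
     (\<forall>i<?n. rec_eval (gs ! i) (map s args) = Some (ys ! i)) \<longrightarrow>
     runs p s (\<lambda>r. if k \<le> r \<and> r < k + ?n then ys ! (r - k) else s r)"
    using compilable_list[OF gs *(1) order_refl] by blast
  have "\<exists>q. implements q f ?rs out (k + ?n)"
    using f * unfolding compilable_def by auto
  then obtain q where q: "implements q f ?rs out (k + ?n)" ..
  let ?c = "map (\<lambda>r. Loop r []) ?rs"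
  have "implements (p @ q @ ?c) (Comp f gs) args out k"
    unfolding implements_def
  proof (intro allI impI)
    fix s :: "nat \<Rightarrow> nat" and y
    assume s: "\<forall>r\<ge>k. s r = 0" and ev: "rec_eval (Comp f gs) (map s args) = Some y"
    define ys where "ys = map (\<lambda>g. the (rec_eval g (map s args))) gs"
    have none: "None \<notin> set (map (\<lambda>g. rec_eval g (map s args)) gs)"
      and y: "rec_eval f ys = Some y"
      using ev by (auto simp: ys_def Let_def comp_def split: if_splits)
    let ?s = "\<lambda>r. if k \<le> r \<and> r < k + ?n then ys ! (r - k) else s r"
    have "rec_eval (gs ! i) (map s args) = Some (ys ! i)" if "i < ?n" for i
    proof -
      have "rec_eval (gs ! i) (map s args) \<in> set (map (\<lambda>g. rec_eval g (map s args)) gs)"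
        using that by simp
      with none show ?thesis
        using that by (cases "rec_eval (gs ! i) (map s args)") (auto simp: ys_def)
    qed
    then have 1: "runs p s ?s" using p s by (simp add: ys_def)
    have "map ?s ?rs = ys"
      by (rule nth_equalityI) (auto simp: ys_def)
    then have 2: "runs q ?s (?s(out := ?s out + y))"
      using s y by (intro implementsD[OF q]) auto
    have "(\<lambda>r. if r \<in> set ?rs then 0 else (?s(out := ?s out + y)) r) = s(out := s out + y)"
      using s * by auto
    then show "runs (p @ q @ ?c) s (s(out := s out + y))"
      using runs_append[OF 1 runs_append[OF 2 runs_clear_all[of ?rs]]] by metis
  qed
  then show "\<exists>p. implements p (Comp f gs) args out k" ..
qed

lemma compilable_PrimRec:
  assumes f: "compilable f" and g: "compilable g"
  shows "compilable (PrimRec f g)"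
  unfolding compilable_def
proof (intro allI impI)
  fix args :: "nat list" and out k :: nat
  assume *: "\<forall>r\<in>set args. r < k" "out < k" "out \<notin> set args"
  show "\<exists>p. implements p (PrimRec f g) args out k"
  proof (cases args)
    case Nil
    then show ?thesis by (auto simp: implements_def)
  next
    case (Cons a zs)
    \<comment> \<open>\<open>?c\<close> counts the remaining rounds, \<open>?m\<close> is the index
      of the current one, \<open>?u\<close> holds the current value and \<open>?v\<close> the next
      one until it replaces \<open>?u\<close>.\<close>
    let ?c = k and ?m = "Suc k" and ?u = "k + 2" and ?v = "k + 3"
    have "\<exists>p. implements p f zs ?u (k + 4)"
      by (rule compilableD[OF f]) (use * Cons in fastforce)+
    then obtain p where p: "implements p f zs ?u (k + 4)" ..
    have "\<exists>q. implements q g (?m # ?u # zs) ?v (k + 4)"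
      by (rule compilableD[OF g]) (use * Cons in fastforce)+
    then obtain q where q: "implements q g (?m # ?u # zs) ?v (k + 4)" ..
    let ?body = "q @ [Loop ?u [], Loop ?v [Inc ?u], Inc ?m]"
    let ?prog = "[Loop a [Inc ?c, Inc ?m], Loop ?m [Inc a]] @ p @ [Loop ?c ?body] @
      [Loop ?u [Inc out], Loop ?m []]"
    have "implements ?prog (PrimRec f g) args out k"
      unfolding implements_def
    proof (intro allI impI)
      fix s :: "nat \<Rightarrow> nat" and y
      assume s: "\<forall>r\<ge>k. s r = 0" and ev: "rec_eval (PrimRec f g) (map s args) = Some y"
      let ?xs = "map s zs"
      define Y where "Y = rec_nat (rec_eval f ?xs)
            (\<lambda>m u. case u of None \<Rightarrow> None | Some y \<Rightarrow> rec_eval g (m # y # ?xs))"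
      have Yn: "Y (s a) = Some y" using ev Cons by (simp add: Y_def)
      have Ysuc: "Y (Suc i) = (case Y i of None \<Rightarrow> None | Some y \<Rightarrow> rec_eval g (i # y # ?xs))" for i
        by (simp add: Y_def)
      \<comment> \<open>An undefined value would propagate up to \<open>Y (s a)\<close>, hence the
        induction downwards from \<open>s a\<close>.\<close>
      have Y: "Y i \<noteq> None" if "i \<le> s a" for i
        using that Yn by (induction rule: inc_induct) (auto simp: Ysuc split: option.splits)
      define V where "V i = the (Y i)" for i
      have VS: "rec_eval g (i # V i # ?xs) = Some (V (Suc i))" if "i < s a" for i
        using Y[of i] Y[of "Suc i"] that by (auto simp: Ysuc V_def)
      have V0: "rec_eval f ?xs = Some (V 0)" using Y[of 0] by (auto simp: Y_def V_def)
      have zs: "z < k" "z \<noteq> k" if "z \<in> set zs" for z using * Cons that by auto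
      have a: "a < k" "a \<noteq> out" using * Cons by auto
      \<comment> \<open>\<open>?m\<close> is still zero and serves as the auxiliary register of the
        copy.\<close>
      have 1: "runs [Loop a [Inc ?c, Inc ?m], Loop ?m [Inc a]] s (s(?c := s a))"
        using runs_copy[of a ?c ?m s] s a by simp
      let ?\<sigma> = "\<lambda>i. s(?c := s a - i, ?m := i, ?u := V i)"
      have xs: "map (t(?c := x, ?m := x2, ?u := x3)) zs = map t zs" "map (t(?c := x)) zs = map t zs"
        for t :: "nat \<Rightarrow> nat" and x x2 x3
        using zs by force+
      have 2: "runs p (s(?c := s a)) (?\<sigma> 0)"
        using s V0 by (intro implementsD[OF p]) (auto simp: xs fun_eq_iff)
      have 3: "runs [Loop ?c ?body] (?\<sigma> 0) (?\<sigma> (s a))"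
      proof (rule runs_Loop)
        fix i assume i: "i < s a"
        then show "?\<sigma> i ?c \<noteq> 0" by simp
        let ?t = "(?\<sigma> i)(?c := ?\<sigma> i ?c - 1)"
        have t: "map ?t zs = ?xs" using zs by force
        have "rec_eval g (map ?t (?m # ?u # zs)) = Some (V (Suc i))"
          unfolding list.map t using VS[OF i] by simp
        then have "runs q ?t (?t(?v := V (Suc i)))"
          by (rule implementsD[OF q, rotated]) (use s in auto)
        moreover have "runs [Loop ?u [], Loop ?v [Inc ?u], Inc ?m] (?t(?v := V (Suc i))) (?\<sigma> (Suc i))"
          using runs_Cons[OF runs_clear[of ?u "?t(?v := V (Suc i))"]
             runs_Cons[OF runs_move[of ?v ?u] runs_Inc[of ?m]]] s
          by (auto elim!: back_subst[where P = "runs _ _"])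
        ultimately show "runs ?body ?t (?\<sigma> (Suc i))" by (rule runs_append)
      qed simp
      have V: "V (s a) = y" using Yn by (simp add: V_def)
      have 4: "runs [Loop ?u [Inc out], Loop ?m []] (?\<sigma> (s a)) (s(out := s out + y))"
        using runs_Cons[OF runs_move[of ?u out "?\<sigma> (s a)"] runs_clear[of ?m]] s * V
        by (auto elim!: back_subst[where P = "runs _ _"])
      show "runs ?prog s (s(out := s out + y))"
        by (intro runs_append[OF 1] runs_append[OF 2] runs_append[OF 3] 4)
    qed
    then show ?thesis ..
  qed
qed

lemma compilable_Mu:
  assumes f: "compilable f"
  shows "compilable (Mu f)"
  unfolding compilable_def
proof (intro allI impI)
  fix args :: "nat list" and out k :: nat
  assume *: "\<forall>r\<in>set args. r < k" "out < k" "out \<notin> set args"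
  let ?n = k and ?v = "Suc k" and ?c = "k + 2"
  have "\<exists>p. implements p f (?n # args) ?v (k + 3)"
    by (rule compilableD[OF f]) (use * in fastforce)+
  then obtain p where p: "implements p f (?n # args) ?v (k + 3)" ..
  \<comment> \<open>A loop as conditional: its body clears \<open>?v\<close>, so it runs at most
    once. For a nonzero value it sets \<open>?c\<close> again and passes to the next candidate
    \<open>?n\<close>; for zero, \<open>?c\<close> stays cleared and the search ends.\<close>
  let ?if = "[Loop ?v [Loop ?v [], Inc ?c, Inc ?n]]"
  let ?prog = "[Inc ?c] @ [Loop ?c (p @ ?if)] @ [Loop ?n [Inc out]]"
  have "implements ?prog (Mu f) args out k"
    unfolding implements_def
  proof (intro allI impI)
    fix s :: "nat \<Rightarrow> nat" and y
    assume s: "\<forall>r\<ge>k. s r = 0" and ev: "rec_eval (Mu f) (map s args) = Some y"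
    let ?xs = "map s args"
    obtain n where n: "rec_eval f (n # ?xs) = Some 0" "\<forall>m<n. rec_eval f (m # ?xs) \<noteq> None"
      and y: "y = (LEAST n. rec_eval f (n # ?xs) = Some 0)"
      using ev by (auto split: if_splits)
    have y0: "rec_eval f (y # ?xs) = Some 0" unfolding y using n(1) by (rule LeastI)
    have "y \<le> n" unfolding y using n(1) by (rule Least_le)
    have V: "\<exists>w. rec_eval f (i # ?xs) = Some w \<and> w \<noteq> 0" if "i < y" for i
      using not_less_Least[of i "\<lambda>n. rec_eval f (n # ?xs) = Some 0"] that n(2) \<open>y \<le> n\<close>
      unfolding y[symmetric] by (metis less_le_trans option.exhaust)
    \<comment> \<open>Round \<open>y\<close> finds the zero and does not set \<open>?c\<close>
      again, hence \<open>Suc y\<close> rounds and a different form of the last store.\<close>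
    let ?\<sigma> = "\<lambda>i. if i \<le> y then s(?c := 1, ?n := i) else s(?n := y)"
    have map: "map (s(?n := x)) args = ?xs" for x using * by force
    have "runs [Loop ?c (p @ ?if)] (?\<sigma> 0) (?\<sigma> (Suc y))"
    proof (rule runs_Loop)
      fix i assume "i < Suc y"
      then have i: "i \<le> y" by simp
      then show "?\<sigma> i ?c \<noteq> 0" by simp
      have t: "(?\<sigma> i)(?c := ?\<sigma> i ?c - 1) = s(?n := i)" using i s by auto
      have p': "runs p (s(?n := i)) (s(?n := i, ?v := w))" if "rec_eval f (i # ?xs) = Some w" for w
        using s that by (intro implementsD[OF p]) (auto simp: map)
      show "runs (p @ ?if) ((?\<sigma> i)(?c := ?\<sigma> i ?c - 1)) (?\<sigma> (Suc i))"
        unfolding t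
      proof (cases "i = y")
        case True
        then have "s(?n := i, ?v := 0) = ?\<sigma> (Suc i)" using s by auto
        with runs_append[OF p'[of 0] runs_Loop_exit[of "s(?n := i, ?v := 0)" ?v]] y0 True
        show "runs (p @ ?if) (s(?n := i)) (?\<sigma> (Suc i))" by simp
      next
        case False
        with i V[of i] obtain w where w: "rec_eval f (i # ?xs) = Some w" "w \<noteq> 0" by auto
        let ?t = "s(?n := i, ?v := w)"
        let ?t' = "?t(?v := w - 1)"
        have "runs [Loop ?v [], Inc ?c, Inc ?n] ?t' (?\<sigma> (Suc i))"
          using runs_Cons[OF runs_clear[of ?v ?t'] runs_Cons[OF runs_Inc[of ?c] runs_Inc[of ?n]]]
            s i False
          by (auto elim!: back_subst[where P = "runs _ _"])
        then have "runs ?if ?t (?\<sigma> (Suc i))"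
          using w s i False by (intro runs_Loop_enter[OF _ _ runs_Loop_exit]) auto
        then show "runs (p @ ?if) (s(?n := i)) (?\<sigma> (Suc i))" by (rule runs_append[OF p'[OF w(1)]])
      qed
    qed (use s in auto)
    moreover have "s(?c := Suc (s ?c)) = ?\<sigma> 0" using s by auto
    ultimately have 2: "runs [Loop ?c (p @ ?if)] (s(?c := Suc (s ?c))) (s(?n := y))" by simp
    have 3: "runs [Loop ?n [Inc out]] (s(?n := y)) (s(out := s out + y))"
      using runs_move[of ?n out "s(?n := y)"] s *
      by (auto elim!: back_subst[where P = "runs _ _"])
    show "runs ?prog s (s(out := s out + y))"
      by (rule runs_append[OF runs_Inc runs_append[OF 2 3]])
  qed
  then show "\<exists>p. implements p (Mu f) args out k" ..
qed

lemma all_compilable: "compilable f"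
  by (induction f) (simp_all add: compilable_Zero compilable_Succ compilable_Proj
      compilable_Comp compilable_PrimRec compilable_Mu)


section \<open>Counting vectors that witness a wrong guess\<close>

text \<open>The automaton cannot see the store, so the letter alone decides a test: 0 claims that
  the register is zero, any other letter that it is not.\<close>

fun next_code :: "instr list \<Rightarrow> nat \<Rightarrow> instr list" where
  "next_code [] a = []"
| "next_code (Inc r # cs) a = cs"
| "next_code (Loop r b # cs) a = (if a = 0 then cs else b @ Loop r b # cs)"

fun claim :: "instr list \<Rightarrow> nat \<Rightarrow> nat option" where
  "claim (Loop r b # cs) a = (if a = 0 then Some r else None)"
| "claim _ a = None"

fun head_reg :: "instr list \<Rightarrow> nat" where
  "head_reg [] = 0"
| "head_reg (Inc r # cs) = r"
| "head_reg (Loop r b # cs) = r"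

fun change :: "nat \<Rightarrow> instr list \<Rightarrow> nat \<Rightarrow> nat \<Rightarrow> nat" where
  "change R [] a j = of_bool (j = 3 * R + 1)"
| "change R (Inc r # cs) a j = of_bool (j = r)"
| "change R (Loop r b # cs) a j = of_bool (a \<noteq> 0 \<and> j = R + r)"

definition flag :: "nat \<Rightarrow> nat option \<Rightarrow> nat \<Rightarrow> nat" where
  "flag R fl j = of_bool (\<exists>r. fl = Some r \<and> j = 2 * R + r)"

text \<open>
  Coordinates of the counting vectors, for \<open>R\<close> registers: \<open>r\<close> and \<open>R + r\<close> count the increments and
  decrements of register \<open>r < R\<close>. A claim that \<open>r\<close> is zero increments \<open>2 * R + r\<close> when it is made
  and again on the next letter, so the parity of this coordinate tells whether the claim has just
  been made. Coordinate \<open>3 * R\<close> counts the transitions from the initial state and \<open>3 * R + 1\<close>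
  those from halted states.
\<close>

definition bad :: "nat \<Rightarrow> (nat \<Rightarrow> nat) \<Rightarrow> bool" where
  "bad R v \<longleftrightarrow> v (3 * R) = 0 \<or> v (3 * R + 1) \<noteq> 0 \<or>
     (\<exists>r<R. v r < v (R + r) \<or> (v (R + r) < v r \<and> odd (v (2 * R + r))))"

text \<open>The invariant as long as all guesses are correct: \<open>s\<close> is the true store and
  \<open>fl\<close> the zero claim made by the last letter.\<close>

definition tracks :: "nat \<Rightarrow> (nat \<Rightarrow> nat) \<Rightarrow> nat option \<Rightarrow> (nat \<Rightarrow> nat) \<Rightarrow> bool" where
  "tracks R v fl s \<longleftrightarrow> v (3 * R) \<noteq> 0 \<and> v (3 * R + 1) = 0 \<and>
     (\<forall>r<R. v r = v (R + r) + s r \<and> (odd (v (2 * R + r)) \<longleftrightarrow> fl = Some r)) \<and>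
     (\<forall>r. fl = Some r \<longrightarrow> r < R \<and> s r = 0)"

fun correct :: "config \<Rightarrow> nat \<Rightarrow> bool" where
  "correct ([], s) a \<longleftrightarrow> False"
| "correct (Inc r # cs, s) a \<longleftrightarrow> True"
| "correct (Loop r b # cs, s) a \<longleftrightarrow> (a = 0 \<longleftrightarrow> s r = 0)"

lemma tracks_imp_not_bad:
  assumes "tracks R v fl s"
  shows "\<not> bad R v"
proof -
  have "\<not> (v r < v (R + r) \<or> (v (R + r) < v r \<and> odd (v (2 * R + r))))" if "r < R" for r
  proof -
    have "v r = v (R + r) + s r" "odd (v (2 * R + r)) \<Longrightarrow> s r = 0"
      using assms that unfolding tracks_def by blast+
    then show ?thesis by auto
  qed
  then show ?thesis using assms unfolding tracks_def bad_def by metis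
qed

lemma correct_step: "correct (cs, s) a \<Longrightarrow> fst (step (cs, s)) = next_code cs a"
  by (cases "(cs, s)" rule: step.cases) auto

text \<open>A new claim and the expiry of the previous one each add 1. Thus a repeated claim keeps
  its coordinate odd, and an increment right after a claim comes with the letter that makes it even
  again.\<close>

lemma tracks_step:
  assumes inv: "tracks R v fl s" and "correct (cs, s) a" and "head_reg cs < R"
  shows "tracks R (\<lambda>j. v j + (flag R fl j + flag R (claim cs a) j + change R cs a j))
    (claim cs a) (snd (step (cs, s)))"
proof -
  have flag: "flag R fl' (3 * R) = 0" "flag R fl' (Suc (3 * R)) = 0" "r < R \<Longrightarrow> flag R fl' r = 0"
    "r < R \<Longrightarrow> flag R fl' (R + r) = 0" "flag R fl' (2 * R + r) = of_bool (fl' = Some r)"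
    if "\<And>r. fl' = Some r \<Longrightarrow> r < R" for fl' r
    using that by (auto simp: flag_def)
  have fl: "\<And>r. fl = Some r \<Longrightarrow> r < R" using inv by (simp add: tracks_def)
  have cl: "\<And>r. claim cs a = Some r \<Longrightarrow> r < R"
    using assms(3) by (cases "(cs, a)" rule: claim.cases) (auto split: if_splits)
  note inv = inv[unfolded tracks_def]
  show ?thesis
  proof (cases "(cs, s)" rule: step.cases)
    case (2 r ds t)
    then show ?thesis
      using inv assms(3) by (auto simp: tracks_def flag[OF fl] flag[OF cl])
  next
    case (3 r b ds t)
    show ?thesis
    proof (cases "a = 0")
      case True
      then show ?thesis
        using 3 inv assms(2,3) by (auto simp: tracks_def flag[OF fl] flag[OF cl])
    next
      case False
      then show ?thesis
        using 3 inv assms(2,3) by (auto simp: tracks_def flag[OF fl] flag[OF cl])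
    qed
  qed (use assms(2) in auto)
qed

text \<open>A wrong "nonzero" makes the decrements exceed the increments. A wrong "zero" turns the
  parity odd while the increments are ahead; no claim was pending for that register, as it is not
  zero. A letter read in a halted state shows in coordinate \<open>3 * R + 1\<close>.\<close>

lemma bad_step:
  assumes "tracks R v fl s" "\<not> correct (cs, s) a" "head_reg cs < R"
  shows "bad R (\<lambda>j. v j + (flag R fl j + flag R (claim cs a) j + change R cs a j))"
proof (cases "(cs, s)" rule: step.cases)
  case (3 r b ds t)
  have fl: "flag R fl r = 0" "flag R fl (R + r) = 0" "flag R fl (2 * R + r) = of_bool (fl = Some r)"
    using assms(1,3) 3 by (auto simp: flag_def tracks_def)
  have r: "r < R" "v r = v (R + r) + s r" "odd (v (2 * R + r)) \<longleftrightarrow> fl = Some r" "fl = Some r \<Longrightarrow> s r = 0"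
    using assms(1,3) 3 by (simp_all add: tracks_def)
  show ?thesis
    unfolding bad_def
  proof (rule disjI2, rule disjI2, rule exI, rule conjI)
    show "r < R" by fact
    show "v r + (flag R fl r + flag R (claim cs a) r + change R cs a r)
        < v (R + r) + (flag R fl (R + r) + flag R (claim cs a) (R + r) + change R cs a (R + r)) \<or>
      v (R + r) + (flag R fl (R + r) + flag R (claim cs a) (R + r) + change R cs a (R + r))
        < v r + (flag R fl r + flag R (claim cs a) r + change R cs a r) \<and>
      odd (v (2 * R + r) + (flag R fl (2 * R + r) + flag R (claim cs a) (2 * R + r) + change R cs a (2 * R + r)))"
    proof (cases "a = 0")
      case True
      then show ?thesis using 3 assms(2) r by (simp add: fl) (auto simp: flag_def)
    next
      case False
      then show ?thesis using 3 assms(2) r by (simp add: fl) (auto simp: flag_def)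
    qed
  qed
qed (use assms in \<open>auto simp: bad_def\<close>)

type_synonym control = "(nat option \<times> instr list) option"

section \<open>Linear sets for the disjuncts of \<open>bad\<close>\<close>

definition vec :: "nat \<Rightarrow> (nat \<Rightarrow> nat) \<Rightarrow> nat list" where
  "vec d f = map f [0..<d]"

definition linear_gen :: "nat \<Rightarrow> (nat \<Rightarrow> nat) \<Rightarrow> (nat \<Rightarrow> nat \<Rightarrow> nat) \<Rightarrow> (nat \<Rightarrow> bool) \<Rightarrow>
    nat list \<times> nat list list" where
  "linear_gen d b u I = (vec d b, map (\<lambda>i. vec d (u i)) (filter I [0..<d]))"

lemma vec_eq_iff: "vec d f = vec d g \<longleftrightarrow> (\<forall>j<d. f j = g j)"
  by (auto simp: vec_def)

lemma length_vec [simp]: "length (vec d f) = d"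
  by (simp add: vec_def)

lemma vec_nth [simp]: "j < d \<Longrightarrow> vec d f ! j = f j"
  by (simp add: vec_def)

text \<open>Coefficients in \<open>linear_set\<close> belong to period vectors, not to indices. The
  assumptions make the periods pairwise distinct, so the sum can be reindexed.\<close>

lemma linear_set_linear_gen:
  assumes "\<And>i. u i i \<noteq> 0" "\<And>i i'. u i i' \<noteq> 0 \<Longrightarrow> u i' i \<noteq> 0 \<Longrightarrow> i = i'"
  shows "vec d f \<in> (case linear_gen d b u I of (b, P) \<Rightarrow> linear_set d b (set P)) \<longleftrightarrow>
    (\<exists>z. \<forall>j<d. f j = b j + (\<Sum>i | i < d \<and> I i. u i j * z i))"
proof -
  let ?J = "{i. i < d \<and> I i}" and ?u = "\<lambda>i. vec d (u i)"
  have inj: "inj_on ?u ?J"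
  proof (rule inj_onI)
    fix x y assume "x \<in> ?J" "y \<in> ?J" "?u x = ?u y"
    then have "u x y = u y y" "u y x = u x x" by (simp_all add: vec_eq_iff)
    then show "x = y" using assms(1)[of x] assms(1)[of y] assms(2)[of x y] by simp
  qed
  have sum: "(\<Sum>p\<in>?u ` ?J. p ! j * z p) = (\<Sum>i\<in>?J. u i j * z (?u i))" if "j < d" for j z
    using that by (simp add: sum.reindex[OF inj])
  have "vec d f \<in> (case linear_gen d b u I of (b, P) \<Rightarrow> linear_set d b (set P)) \<longleftrightarrow>
     (\<exists>z. vec d f = vec d (\<lambda>j. vec d b ! j + (\<Sum>p\<in>?u ` ?J. p ! j * z p)))"
    by (simp add: linear_gen_def linear_set_def vec_def[of d "\<lambda>j. _ j + _ j"] lessThan_def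
        conj_commute flip: lessThan_atLeast0)
  also have "\<dots> \<longleftrightarrow> (\<exists>z. \<forall>j<d. f j = b j + (\<Sum>i\<in>?J. u i j * z (?u i)))"
    by (simp add: vec_eq_iff sum)
  also have "\<dots> \<longleftrightarrow> (\<exists>z. \<forall>j<d. f j = b j + (\<Sum>i\<in>?J. u i j * z i))"
  proof
    assume "\<exists>z. \<forall>j<d. f j = b j + (\<Sum>i\<in>?J. u i j * z i)"
    then obtain z where z: "\<forall>j<d. f j = b j + (\<Sum>i\<in>?J. u i j * z i)" ..
    have "(\<Sum>i\<in>?J. u i j * z (inv_into ?J ?u (?u i))) = (\<Sum>i\<in>?J. u i j * z i)" for j
      by (intro sum.cong) (auto simp: inv_into_f_f[OF inj])
    with z show "\<exists>z. \<forall>j<d. f j = b j + (\<Sum>i\<in>?J. u i j * z (?u i))"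
      by (intro exI[of _ "\<lambda>p. z (inv_into ?J ?u p)"]) simp
  qed (auto intro: exI[of _ "\<lambda>i. _ (?u i)"])
  finally show ?thesis .
qed

lemma sum_of_bool_mult:
  fixes z :: "nat \<Rightarrow> nat"
  shows "finite I \<Longrightarrow> (\<Sum>i\<in>I. of_bool (j = i \<and> P) * z i) = (if j \<in> I \<and> P then z j else 0)"
    "finite I \<Longrightarrow> (\<Sum>i\<in>I. of_bool (i = x \<and> P) * z i) = (if x \<in> I \<and> P then z x else 0)"
    "finite I \<Longrightarrow> (\<Sum>i\<in>I. of_bool (j = i) * z i) = (if j \<in> I then z j else 0)"
  by (auto simp: of_bool_def if_distrib[of "\<lambda>x. x * _"] sum.delta sum.delta' cong: if_cong)

lemma vec_in_zero_gen:
  assumes "k < d"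
  shows "vec d f \<in> (case linear_gen d (\<lambda>_. 0) (\<lambda>i j. of_bool (j = i)) (\<lambda>i. i \<noteq> k) of
      (b, P) \<Rightarrow> linear_set d b (set P)) \<longleftrightarrow> f k = 0"
  using assms by (subst linear_set_linear_gen)
    (auto simp: sum_of_bool_mult simp del: sum_of_bool_mult_eq intro!: exI[of _ f] split: if_splits)

lemma vec_in_pos_gen:
  assumes "k < d"
  shows "vec d f \<in> (case linear_gen d (\<lambda>j. of_bool (j = k)) (\<lambda>i j. of_bool (j = i)) (\<lambda>_. True) of
      (b, P) \<Rightarrow> linear_set d b (set P)) \<longleftrightarrow> f k \<noteq> 0"
  using assms by (subst linear_set_linear_gen)
    (auto simp: sum_of_bool_mult intro!: exI[of _ "\<lambda>j. f j - of_bool (j = k)"])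

text \<open>All periods are unit vectors, except that the one at \<open>x\<close> also adds 1 at
  \<open>y\<close>; the base adds one more at \<open>y\<close>, which makes the inequality
  strict.\<close>

lemma vec_in_less_gen:
  assumes "x < d" "y < d" "x \<noteq> y"
  shows "vec d f \<in> (case linear_gen d (\<lambda>j. of_bool (j = y))
        (\<lambda>i j. of_bool (j = i) + of_bool (i = x \<and> j = y)) (\<lambda>_. True) of
      (b, P) \<Rightarrow> linear_set d b (set P)) \<longleftrightarrow> f x < f y"
proof (subst linear_set_linear_gen)
  show "(\<exists>z. \<forall>j<d. f j = of_bool (j = y) +
      (\<Sum>i | i < d \<and> True. (of_bool (j = i) + of_bool (i = x \<and> j = y)) * z i)) \<longleftrightarrow> f x < f y"
    (is "?L \<longleftrightarrow> _")
  proof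
    assume "f x < f y"
    with assms show ?L
      \<comment> \<open>The coefficient at \<open>y\<close> is the surplus left after the base and
        the shared period at \<open>x\<close>.\<close>
      by (intro exI[of _ "f(y := f y - f x - 1)"]) (auto simp: sum_of_bool_mult distrib_right sum.distrib)
  qed (use assms in \<open>auto simp: sum_of_bool_mult distrib_right sum.distrib\<close>)
qed (use assms in auto)

text \<open>The comparison uses a shared period at \<open>y\<close>. At \<open>w\<close> the period
  is twice the unit vector and the base adds 1, which yields exactly the odd values.\<close>

lemma vec_in_odd_gen:
  assumes "x < d" "y < d" "w < d" "x \<noteq> y" "x \<noteq> w" "y \<noteq> w"
  shows "vec d f \<in> (case linear_gen d (\<lambda>j. of_bool (j = x) + of_bool (j = w))
        (\<lambda>i j. of_bool (j = i) + of_bool (i = y \<and> j = x) + of_bool (i = w \<and> j = w)) (\<lambda>_. True) of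
      (b, P) \<Rightarrow> linear_set d b (set P)) \<longleftrightarrow> f y < f x \<and> odd (f w)"
proof (subst linear_set_linear_gen)
  have fin: "finite {i. i < d \<and> True}" by simp
  have sum: "(\<Sum>i | i < d \<and> True.
        (of_bool (j = i) + of_bool (i = y \<and> j = x) + of_bool (i = w \<and> j = w)) * z i) =
      (if j < d then z j else 0) + (if j = x then z y else 0) + (if j = w then z w else 0)"
    for j and z :: "nat \<Rightarrow> nat"
    using assms unfolding distrib_right sum.distrib sum_of_bool_mult[OF fin] by simp
  show "(\<exists>z. \<forall>j<d. f j = of_bool (j = x) + of_bool (j = w) +
      (\<Sum>i | i < d \<and> True.
        (of_bool (j = i) + of_bool (i = y \<and> j = x) + of_bool (i = w \<and> j = w)) * z i)) \<longleftrightarrow>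
      f y < f x \<and> odd (f w)"
    unfolding sum using assms
    by (auto elim!: oddE intro!: exI[of _ "f(x := f x - f y - 1, w := f w div 2)"])
qed (use assms in auto)

definition bad_gens :: "nat \<Rightarrow> (nat list \<times> nat list list) list" where
  "bad_gens R = (let d = 3 * R + 2 in
     linear_gen d (\<lambda>_. 0) (\<lambda>i j. of_bool (j = i)) (\<lambda>i. i \<noteq> 3 * R) #
     linear_gen d (\<lambda>j. of_bool (j = 3 * R + 1)) (\<lambda>i j. of_bool (j = i)) (\<lambda>_. True) #
     map (\<lambda>r. linear_gen d (\<lambda>j. of_bool (j = R + r))
        (\<lambda>i j. of_bool (j = i) + of_bool (i = r \<and> j = R + r)) (\<lambda>_. True)) [0..<R] @
     map (\<lambda>r. linear_gen d (\<lambda>j. of_bool (j = r) + of_bool (j = 2 * R + r))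
        (\<lambda>i j. of_bool (j = i) + of_bool (i = R + r \<and> j = r) +
          of_bool (i = 2 * R + r \<and> j = 2 * R + r)) (\<lambda>_. True)) [0..<R])"

lemma vec_in_bad_gens:
  "(\<exists>g\<in>set (bad_gens R). vec (3 * R + 2) f \<in> (case g of (b, P) \<Rightarrow> linear_set (3 * R + 2) b (set P)))
     \<longleftrightarrow> bad R f"
proof -
  define d where "d = 3 * R + 2"
  define M where "M g \<longleftrightarrow> vec d f \<in> (case g of (b, P) \<Rightarrow> linear_set d b (set P))" for g
  have ex: "(\<exists>g\<in>set (g1 # g2 # map F [0..<R] @ map G [0..<R]). M g) \<longleftrightarrow>
      M g1 \<or> M g2 \<or> (\<exists>r<R. M (F r)) \<or> (\<exists>r<R. M (G r))" for g1 g2 F G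
    by auto
  have 1: "M (linear_gen d (\<lambda>_. 0) (\<lambda>i j. of_bool (j = i)) (\<lambda>i. i \<noteq> 3 * R)) \<longleftrightarrow> f (3 * R) = 0"
    unfolding M_def by (rule vec_in_zero_gen) (simp add: d_def)
  have 2: "M (linear_gen d (\<lambda>j. of_bool (j = 3 * R + 1)) (\<lambda>i j. of_bool (j = i)) (\<lambda>_. True)) \<longleftrightarrow>
      f (3 * R + 1) \<noteq> 0"
    unfolding M_def by (rule vec_in_pos_gen) (simp add: d_def)
  have 3: "(\<exists>r<R. M (linear_gen d (\<lambda>j. of_bool (j = R + r))
        (\<lambda>i j. of_bool (j = i) + of_bool (i = r \<and> j = R + r)) (\<lambda>_. True))) \<longleftrightarrow>
      (\<exists>r<R. f r < f (R + r))"
    unfolding M_def by (intro ex_cong1 conj_cong refl vec_in_less_gen) (auto simp: d_def)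
  have 4: "(\<exists>r<R. M (linear_gen d (\<lambda>j. of_bool (j = r) + of_bool (j = 2 * R + r))
        (\<lambda>i j. of_bool (j = i) + of_bool (i = R + r \<and> j = r) +
          of_bool (i = 2 * R + r \<and> j = 2 * R + r)) (\<lambda>_. True))) \<longleftrightarrow>
      (\<exists>r<R. f (R + r) < f r \<and> odd (f (2 * R + r)))"
    unfolding M_def by (intro ex_cong1 conj_cong refl vec_in_odd_gen) (auto simp: d_def)
  have "(\<exists>g\<in>set (bad_gens R). M g) \<longleftrightarrow> bad R f"
    unfolding bad_gens_def Let_def d_def[symmetric] ex 1 2 3 4 bad_def by blast
  then show ?thesis unfolding M_def d_def .
qed

lemma generators_bad_gens:
  "generators (3 * R + 2) ((\<lambda>(b, ps). (b, set ps)) ` set (bad_gens R))"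
proof -
  let ?d = "3 * R + 2"
  have "length (fst (linear_gen d b u I)) = d \<and> (\<forall>p\<in>set (snd (linear_gen d b u I)). length p = d)"
    for d b u I
    by (auto simp: linear_gen_def)
  then have "\<forall>g\<in>set (bad_gens R). length (fst g) = ?d \<and> (\<forall>p\<in>set (snd g). length p = ?d)"
    unfolding bad_gens_def Let_def list.set set_append set_map by blast
  then show ?thesis by (auto simp: generators_def)
qed


section \<open>The automaton of a register program\<close>

text \<open>\<open>None\<close> is the initial state, never entered again. In
  \<open>Some (fl, cs)\<close>, \<open>fl\<close> remembers the claim of the last letter, so that
  its parity can be flipped back.\<close>

fun next_control :: "instr list \<Rightarrow> control \<Rightarrow> nat \<Rightarrow> control" where
  "next_control p None a = Some (None, p)"
| "next_control p (Some (fl, cs)) a = Some (claim cs a, next_code cs a)"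

fun weight :: "nat \<Rightarrow> nat list \<Rightarrow> control \<Rightarrow> nat \<Rightarrow> nat \<Rightarrow> nat" where
  "weight R xs None a j = (if j < length xs then xs ! j else of_bool (j = 3 * R))"
| "weight R xs (Some (fl, cs)) a j = flag R fl j + flag R (claim cs a) j + change R cs a j"

definition edge :: "nat \<Rightarrow> instr list \<Rightarrow> nat list \<Rightarrow> control \<Rightarrow> nat \<Rightarrow> (nat, nat) transition" where
  "edge R p xs s a = (to_nat s, a, vec (3 * R + 2) (weight R xs s a), to_nat (next_control p s a))"

definition running_controls :: "nat \<Rightarrow> instr list list \<Rightarrow> control list" where
  "running_controls R ps = map Some (List.product (None # map Some [0..<R]) ps)"

definition edges :: "nat \<Rightarrow> instr list \<Rightarrow> nat list \<Rightarrow> control list \<Rightarrow> (nat, nat) transition list" where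
  "edges R p xs ss = concat (map (\<lambda>s. [edge R p xs s 0, edge R p xs s 1]) ss)"

text \<open>Keeping \<open>xs\<close> separate from \<open>p\<close> later allows the data to
  describe the automaton itself.\<close>

definition program_presentation ::
  "nat \<Rightarrow> instr list list \<Rightarrow> instr list \<Rightarrow> nat list \<Rightarrow> presentation" where
  "program_presentation R ps p xs = (let ss = None # running_controls R ps in \<lparr>
     pdim = 3 * R + 2,
     pstates = map to_nat ss,
     palphabet = [0, 1],
     pinit = to_nat (None :: control),
     ptrans = edges R p xs ss,
     pacc = map to_nat ss,
     pgens = bad_gens R\<rparr>)"

section \<open>Runs and acceptance of the automaton\<close>

definition load :: "nat list \<Rightarrow> nat \<Rightarrow> nat" where
  "load xs r = (if r < length xs then xs ! r else 0)"

primrec path :: "instr list \<Rightarrow> (nat \<Rightarrow> nat) \<Rightarrow> nat \<Rightarrow> control" where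
  "path p \<alpha> 0 = None"
| "path p \<alpha> (Suc i) = next_control p (path p \<alpha> i) (\<alpha> i)"

lemma path_Suc_not_None: "path p \<alpha> (Suc i) \<noteq> None"
  by (cases "(p, path p \<alpha> i, \<alpha> i)" rule: next_control.cases) auto

text \<open>\<open>ps\<close> lists enough codes to follow every guess. By \<open>length_xs\<close>
  the loaded data only reach increment counters, so they act as initial register contents.\<close>

locale program_automaton =
  fixes R :: nat and ps :: "instr list list" and p :: "instr list" and xs :: "nat list"
  assumes start: "p \<in> set ps"
    and closed: "cs \<in> set ps \<Longrightarrow> next_code cs a \<in> set ps"
    and head_reg: "cs \<in> set ps \<Longrightarrow> head_reg cs < R"
    and length_xs: "length xs \<le> R"
begin

definition A :: "(nat, nat) parikh_automaton" where
  "A = automaton_of (program_presentation R ps p xs)"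

definition controls :: "control set" where
  "controls = insert None (Some ` (insert None (Some ` {..<R}) \<times> set ps))"

lemma set_controls: "set (None # running_controls R ps) = controls"
  by (auto simp: controls_def running_controls_def)

lemma finite_controls: "finite controls"
  by (simp flip: set_controls)

lemma A_simps:
  "dimension A = 3 * R + 2" "states A = to_nat ` controls" "alphabet A = {0, 1}"
  "initial A = to_nat (None :: control)" "accepting A = to_nat ` controls"
  "transitions A = {edge R p xs s a | s a. s \<in> controls \<and> a \<in> {0, 1}}"
  "constraint A = semilinear_set (3 * R + 2) ((\<lambda>(b, ps). (b, set ps)) ` set (bad_gens R))"
  unfolding A_def automaton_of_def program_presentation_def Let_def edges_def
  by (auto simp: gens_of_def set_controls simp del: list.set(2) set_map simp flip: set_controls)
     auto

lemma vec_in_constraint: "vec (3 * R + 2) f \<in> constraint A \<longleftrightarrow> bad R f"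
  unfolding A_simps vec_in_bad_gens[symmetric]
  by (simp add: semilinear_set_def case_prod_unfold)

lemma claim_less: "cs \<in> set ps \<Longrightarrow> claim cs a = Some r \<Longrightarrow> r < R"
  using head_reg[of cs] by (cases "(cs, a)" rule: claim.cases) (auto split: if_splits)

lemma next_control_closed: "s \<in> controls \<Longrightarrow> next_control p s a \<in> controls"
  using start closed claim_less
  by (cases "(p, s, a)" rule: next_control.cases; cases "claim (snd (the s)) a")
    (auto simp: controls_def)

lemma path_in_controls: "path p \<alpha> i \<in> controls"
  by (induction i) (auto simp: next_control_closed, simp add: controls_def)

text \<open>Hence every infix after the first letter has coordinate \<open>3 * R\<close> equal to 0
  and is in the constraint.\<close>

lemma weight_entry: "s \<in> controls \<Longrightarrow> s \<noteq> None \<Longrightarrow> weight R xs s a (3 * R) = 0"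
  using head_reg[of "snd (the s)"]
  by (cases "(R, xs, s, a, 3 * R)" rule: weight.cases;
      cases "(R, snd (the s), a, 3 * R)" rule: change.cases)
    (auto simp: controls_def flag_def split: if_splits)

lemma deterministic_PA: "program_presentation R ps p xs \<in> deterministic_PAs"
proof -
  have gens: "generators (3 * R + 2) (gens_of (program_presentation R ps p xs))"
    using generators_bad_gens by (simp add: gens_of_def program_presentation_def Let_def)
  have "finite ((\<lambda>(s, a). edge R p xs s a) ` (controls \<times> {0, 1}))"
    using finite_controls by simp
  also have "(\<lambda>(s, a). edge R p xs s a) ` (controls \<times> {0, 1}) = transitions A"
    by (auto simp: A_simps)
  finally have "finite (transitions A)" .
  moreover have "semilinear (dimension A) (constraint A)"
    unfolding semilinear_def A_simps using generators_bad_gens by blast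
  ultimately have "is_PA A"
    using finite_controls next_control_closed
    by (auto simp: is_PA_def A_simps edge_def) (auto simp: controls_def)
  moreover have "deterministic A"
    unfolding deterministic_def
  proof (intro ballI)
    fix q a assume "q \<in> states A" "a \<in> alphabet A"
    then obtain s where s: "s \<in> controls" "q = to_nat s" "a \<in> {0, 1}" by (auto simp: A_simps)
    then show "\<exists>!t. t \<in> transitions A \<and> (\<exists>v q'. t = (q, a, v, q'))"
      by (intro ex1I[of _ "edge R p xs s a"]) (auto simp: A_simps edge_def)
  qed
  ultimately show ?thesis
    using gens by (simp add: deterministic_PAs_def presents_PA_def A_def[symmetric])
      (simp add: program_presentation_def Let_def)
qed

lemma is_run_iff:
  assumes "\<forall>i. \<alpha> i \<in> alphabet A"
  shows "is_run A \<alpha> r \<longleftrightarrow> r = (\<lambda>i. edge R p xs (path p \<alpha> i) (\<alpha> i))"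
proof
  assume run: "is_run A \<alpha> r"
  have edge: "r i = edge R p xs s (\<alpha> i)" if "source (r i) = to_nat s" for i s
  proof -
    have "r i \<in> transitions A" "letter (r i) = \<alpha> i" using run by (auto simp: is_run_def)
    with that show ?thesis by (auto simp: A_simps edge_def)
  qed
  have "source (r i) = to_nat (path p \<alpha> i)" for i
  proof (induction i)
    case 0
    then show ?case using run by (simp add: is_run_def A_simps)
  next
    case (Suc i)
    from edge[OF this] show ?case using run unfolding is_run_def
      by (metis edge_def path.simps(2) target.simps)
  qed
  then show "r = (\<lambda>i. edge R p xs (path p \<alpha> i) (\<alpha> i))" using edge by blast
next
  assume "r = (\<lambda>i. edge R p xs (path p \<alpha> i) (\<alpha> i))"
  then show "is_run A \<alpha> r"
    using assms path_in_controls by (auto simp: is_run_def A_simps) (auto simp: edge_def)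
qed

definition total :: "(nat \<Rightarrow> nat) \<Rightarrow> nat \<Rightarrow> nat \<Rightarrow> nat" where
  "total \<alpha> n j = (\<Sum>i<n. weight R xs (path p \<alpha> i) (\<alpha> i) j)"

lemma rho_run:
  "rho A (\<lambda>i. edge R p xs (path p \<alpha> i) (\<alpha> i)) m n =
    vec (3 * R + 2) (\<lambda>j. \<Sum>i\<in>{m..<n}. weight R xs (path p \<alpha> i) (\<alpha> i) j)"
  by (rule nth_equalityI) (simp_all add: rho_def A_simps edge_def del: upt_Suc)

text \<open>The run is unique and all its states are accepting, so reachability only asks for a bad
  prefix. The first reset of a weak reset run is such a prefix, and later resets are free.\<close>

lemma accepts_iff:
  assumes "acc = reach_reg_accepting \<or> acc = weak_reset_accepting"
    and "\<forall>i. \<alpha> i \<in> alphabet A"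
  shows "accepts acc A \<alpha> \<longleftrightarrow> (\<exists>n\<ge>1. bad R (total \<alpha> n))"
proof -
  let ?r = "\<lambda>i. edge R p xs (path p \<alpha> i) (\<alpha> i)"
  have st: "state_at ?r i \<in> accepting A" for i
    using path_in_controls by (simp add: state_at_def edge_def A_simps)
  have pre: "rho A ?r 0 n \<in> constraint A \<longleftrightarrow> bad R (total \<alpha> n)" for n
    unfolding rho_run vec_in_constraint total_def[abs_def] by (simp add: atLeast0LessThan)
  have later: "rho A ?r m (Suc m) \<in> constraint A" if "m \<ge> 1" for m
  proof -
    have "path p \<alpha> m \<noteq> None" using path_Suc_not_None[of p \<alpha> "m - 1"] that by simp
    then show ?thesis
      unfolding rho_run vec_in_constraint bad_def using weight_entry[OF path_in_controls] by simp
  qed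
  have "acc A ?r \<longleftrightarrow> (\<exists>n\<ge>1. bad R (total \<alpha> n))"
  proof (cases "acc = reach_reg_accepting")
    case True
    have "{j. j \<ge> (1::nat)} = {1..}" by auto
    then show ?thesis
      unfolding True reach_reg_accepting_def using st pre by (simp add: infinite_Ici)
  next
    case False
    then have "acc A ?r \<longleftrightarrow> weak_reset_accepting A ?r" using assms by simp
    also have "\<dots> \<longleftrightarrow> (\<exists>n\<ge>1. bad R (total \<alpha> n))"
    proof
      assume "weak_reset_accepting A ?r"
      then obtain k :: "nat \<Rightarrow> nat" where k: "k 0 = 0" "strict_mono k"
        "\<forall>i\<ge>1. rho A ?r (k (i - 1)) (k i) \<in> constraint A"
        unfolding weak_reset_accepting_def by blast
      then have "bad R (total \<alpha> (k 1))" using pre k(3)[rule_format, of 1] by simp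
      moreover have "k 1 \<ge> 1" using k(1) strict_monoD[OF k(2), of 0 1] by simp
      ultimately show "\<exists>n\<ge>1. bad R (total \<alpha> n)" by blast
    next
      assume "\<exists>n\<ge>1. bad R (total \<alpha> n)"
      then obtain n where n: "n \<ge> 1" "bad R (total \<alpha> n)" by blast
      \<comment> \<open>The first reset comes after \<open>n\<close> letters, then one after every
        letter. As \<open>n \<ge> 1\<close>, the later infixes avoid the initial state.\<close>
      define k where "k i = (if i = 0 then 0 else n + i - 1)" for i
      have "rho A ?r (k (i - 1)) (k i) \<in> constraint A" if "i \<ge> 1" for i
      proof (cases "i = 1")
        case False
        then have "k i = Suc (k (i - 1))" "k (i - 1) \<ge> 1" using that n by (auto simp: k_def)
        then show ?thesis using later by simp
      qed (use pre n in \<open>simp add: k_def\<close>)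
      moreover have "strict_mono k" using n by (auto simp: strict_mono_Suc_iff k_def)
      ultimately show "weak_reset_accepting A ?r"
        unfolding weak_reset_accepting_def using st by (intro exI[of _ k]) (simp add: k_def)
    qed
    finally show ?thesis .
  qed
  then show ?thesis unfolding accepts_def is_run_iff[OF assms(2)] by blast
qed

section \<open>Correct guesses simulate the program\<close>

definition conf :: "nat \<Rightarrow> config" where
  "conf i = (step ^^ i) (p, load xs)"

text \<open>The first letter only loads the data, hence the shift: configuration \<open>i\<close>
  belongs to \<open>Suc i\<close> letters read, and \<open>\<alpha> (Suc i)\<close> is the guess
  made there.\<close>

definition simulates :: "(nat \<Rightarrow> nat) \<Rightarrow> nat \<Rightarrow> bool" where
  "simulates \<alpha> i \<longleftrightarrow> fst (conf i) \<in> set ps \<and>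
     (\<exists>fl. path p \<alpha> (Suc i) = Some (fl, fst (conf i)) \<and> tracks R (total \<alpha> (Suc i)) fl (snd (conf i)))"

lemma simulates_0: "simulates \<alpha> 0"
  using start length_xs
  by (auto simp: simulates_def conf_def tracks_def total_def load_def)

lemma total_Suc: "total \<alpha> (Suc n) = (\<lambda>j. total \<alpha> n j + weight R xs (path p \<alpha> n) (\<alpha> n) j)"
  by (simp add: total_def fun_eq_iff)

lemma simulates_Suc:
  assumes "simulates \<alpha> i" "correct (conf i) (\<alpha> (Suc i))"
  shows "simulates \<alpha> (Suc i)"
proof -
  obtain cs s where c: "conf i = (cs, s)" by fastforce
  obtain fl where fl: "cs \<in> set ps" "path p \<alpha> (Suc i) = Some (fl, cs)" "tracks R (total \<alpha> (Suc i)) fl s"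
    using assms(1) c by (auto simp: simulates_def)
  have c': "conf (Suc i) = step (cs, s)" using c by (simp add: conf_def)
  have step: "fst (step (cs, s)) = next_code cs (\<alpha> (Suc i))"
    using correct_step assms(2) c by simp
  show ?thesis
    using tracks_step[OF fl(3) _ head_reg[OF fl(1)], of "\<alpha> (Suc i)"] assms(2) c closed[OF fl(1)]
    unfolding simulates_def c' step total_Suc[of _ "Suc i"] path.simps(2)[of _ _ "Suc i"] fl(2) by simp
qed

lemma simulates_bad:
  assumes "simulates \<alpha> i" "\<not> correct (conf i) (\<alpha> (Suc i))"
  shows "bad R (total \<alpha> (Suc (Suc i)))"
proof -
  obtain cs s where c: "conf i = (cs, s)" by fastforce
  obtain fl where fl: "cs \<in> set ps" "path p \<alpha> (Suc i) = Some (fl, cs)" "tracks R (total \<alpha> (Suc i)) fl s"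
    using assms(1) c by (auto simp: simulates_def)
  show ?thesis
    using bad_step[OF fl(3) _ head_reg[OF fl(1)], of "\<alpha> (Suc i)"] assms(2) c
    unfolding total_Suc[of _ "Suc i"] fl(2) by simp
qed

lemma simulates_not_bad: "simulates \<alpha> i \<Longrightarrow> \<not> bad R (total \<alpha> (Suc i))"
  unfolding simulates_def using tracks_imp_not_bad by blast

text \<open>A word without bad prefix must guess correctly forever, but no letter is correct in a
  halted configuration. If the program never halts, the word of correct guesses is rejected.\<close>

lemma universal_iff_halts:
  assumes "acc = reach_reg_accepting \<or> acc = weak_reset_accepting"
  shows "universal acc A \<longleftrightarrow> (\<exists>m. fst (conf m) = [])"
proof
  assume "\<exists>m. fst (conf m) = []"
  then obtain m where m: "fst (conf m) = []" ..
  have "\<exists>n\<ge>1. bad R (total \<alpha> n)" for \<alpha>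
  proof (rule ccontr)
    assume good: "\<not> (\<exists>n\<ge>1. bad R (total \<alpha> n))"
    then have ok: "simulates \<alpha> i \<Longrightarrow> correct (conf i) (\<alpha> (Suc i))" for i
      using simulates_bad[of \<alpha> i] by (metis One_nat_def Suc_le_mono le0)
    have "simulates \<alpha> i" for i
      by (induction i) (auto simp: simulates_0 simulates_Suc ok)
    then have "correct (conf m) (\<alpha> (Suc m))" by (rule ok)
    then show False using m by (cases "conf m") simp
  qed
  then show "universal acc A" unfolding universal_def using accepts_iff[OF assms] by blast
next
  assume univ: "universal acc A"
  show "\<exists>m. fst (conf m) = []"
  proof (rule ccontr)
    assume run: "\<not> (\<exists>m. fst (conf m) = [])"
    \<comment> \<open>While the program runs, 1 is correct whenever 0 is not. The value at 0, where
      \<open>i - 1\<close> is truncated, is not a guess.\<close>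
    define \<alpha> where "\<alpha> i = (if correct (conf (i - 1)) 0 then 0 else 1 :: nat)" for i
    have "correct (conf i) (\<alpha> (Suc i))" for i
    proof (cases "conf i" rule: step.cases)
      case (1 s)
      then show ?thesis using run by (metis fst_conv)
    qed (auto simp: \<alpha>_def)
    then have "simulates \<alpha> i" for i
      by (induction i) (auto simp: simulates_0 simulates_Suc)
    then have "\<not> bad R (total \<alpha> n)" if "n \<ge> 1" for n
      using simulates_not_bad[of \<alpha> "n - 1"] that by simp
    moreover have alph: "\<forall>i. \<alpha> i \<in> alphabet A" by (auto simp: \<alpha>_def A_simps)
    ultimately show False
      using univ accepts_iff[OF assms alph] unfolding universal_def by blast
  qed
qed

end

section \<open>Finiteness of the set of remaining codes\<close>

lemma finite_code_closure_list:
  assumes "\<And>c cs. c \<in> set p \<Longrightarrow>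
    \<exists>Q. finite Q \<and> c # cs \<in> Q \<and> (\<forall>x\<in>Q. \<forall>a. next_code x a \<in> insert cs Q)"
  shows "\<exists>Q. finite Q \<and> p @ cs \<in> insert cs Q \<and> (\<forall>x\<in>Q. \<forall>a. next_code x a \<in> insert cs Q)"
  using assms
proof (induction p)
  case Nil
  show ?case by (intro exI[of _ "{}"]) simp
next
  case (Cons c p)
  obtain Q where "finite Q" "p @ cs \<in> insert cs Q" "\<forall>x\<in>Q. \<forall>a. next_code x a \<in> insert cs Q"
    using Cons by auto
  moreover obtain Q' where "finite Q'" "c # p @ cs \<in> Q'"
    "\<forall>x\<in>Q'. \<forall>a. next_code x a \<in> insert (p @ cs) Q'"
    using Cons.prems[of c "p @ cs"] by auto
  ultimately show ?case by (intro exI[of _ "Q \<union> Q'"] conjI) (simp, simp, metis Un_iff insert_iff)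
qed

text \<open>The continuation \<open>cs\<close> is the only exit from \<open>Q\<close>. The body of a
  loop runs with continuation \<open>Loop r b # cs\<close> and exits to that same list, so unfolding
  adds only finitely many codes.\<close>

lemma finite_code_closure_instr:
  "\<exists>Q. finite Q \<and> c # cs \<in> Q \<and> (\<forall>x\<in>Q. \<forall>a. next_code x a \<in> insert cs Q)"
proof (induction c arbitrary: cs)
  case (Inc r)
  show ?case by (intro exI[of _ "{Inc r # cs}"]) simp
next
  case (Loop r b)
  obtain Q where "finite Q" "b @ Loop r b # cs \<in> insert (Loop r b # cs) Q"
    "\<forall>x\<in>Q. \<forall>a. next_code x a \<in> insert (Loop r b # cs) Q"
    using finite_code_closure_list[of b, OF Loop] by blast
  then show ?case by (intro exI[of _ "insert (Loop r b # cs) Q"]) auto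
qed

lemma finite_code_closure:
  "\<exists>Q. finite Q \<and> p \<in> Q \<and> (\<forall>x\<in>Q. \<forall>a. next_code x a \<in> Q)"
proof -
  obtain Q where "finite Q" "p \<in> insert [] Q" "\<forall>x\<in>Q. \<forall>a. next_code x a \<in> insert [] Q"
    using finite_code_closure_list[of p "[]"] finite_code_closure_instr by force
  then show ?thesis by (intro exI[of _ "insert [] Q"]) auto
qed

section \<open>Recursiveness of pairing\<close>

definition total_recursive :: "nat \<Rightarrow> (nat list \<Rightarrow> nat) \<Rightarrow> bool" where
  "total_recursive n F \<longleftrightarrow> (\<exists>f. \<forall>xs. length xs = n \<longrightarrow> rec_eval f xs = Some (F xs))"

lemma total_recursive_nth: "i < n \<Longrightarrow> total_recursive n (\<lambda>xs. xs ! i)"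
  unfolding total_recursive_def by (intro exI[of _ "Proj i"]) simp

lemma total_recursive_comp1:
  assumes "\<And>a. rec_eval h [a] = Some (H a)" "total_recursive n F"
  shows "total_recursive n (\<lambda>xs. H (F xs))"
proof -
  obtain f where "\<forall>xs. length xs = n \<longrightarrow> rec_eval f xs = Some (F xs)"
    using assms(2) unfolding total_recursive_def ..
  then show ?thesis
    unfolding total_recursive_def by (intro exI[of _ "Comp h [f]"]) (simp add: assms(1))
qed

lemma total_recursive_comp2:
  assumes "\<And>a b. rec_eval h [a, b] = Some (H a b)" "total_recursive n F" "total_recursive n G"
  shows "total_recursive n (\<lambda>xs. H (F xs) (G xs))"
proof -
  obtain f g where "\<forall>xs. length xs = n \<longrightarrow> rec_eval f xs = Some (F xs)"
    "\<forall>xs. length xs = n \<longrightarrow> rec_eval g xs = Some (G xs)"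
    using assms(2,3) unfolding total_recursive_def by blast
  then show ?thesis
    unfolding total_recursive_def by (intro exI[of _ "Comp h [f, g]"]) (simp add: assms(1))
qed

lemma total_recursive_Suc: "total_recursive n F \<Longrightarrow> total_recursive n (\<lambda>xs. Suc (F xs))"
  by (rule total_recursive_comp1[of Succ]) simp

lemma total_recursive_const: "total_recursive n (\<lambda>_. c)"
proof (induction c)
  case 0
  show ?case unfolding total_recursive_def by (intro exI[of _ Zero]) simp
qed (rule total_recursive_Suc)

text \<open>The pairing is \<open>triangle (m + n) + m\<close>, so addition and triangular numbers
  suffice. With \<open>Suc\<close> it also gives the codes of lists of fixed length.\<close>

lemma total_recursive_prod_encode:
  assumes "total_recursive n F" "total_recursive n G"
  shows "total_recursive n (\<lambda>xs. prod_encode (F xs, G xs))"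
proof -
  let ?add = "PrimRec (Proj 0) (Comp Succ [Proj 1])"
  let ?tri = "PrimRec Zero (Comp ?add [Proj 1, Comp Succ [Proj 0]])"
  have add: "rec_eval ?add [a, b] = Some (a + b)" for a b
    by (simp, induction a) simp_all
  have tri: "rec_eval ?tri [a] = Some (triangle a)" for a
  proof (induction a)
    case (Suc a)
    then show ?case
      using add[of "triangle a" "Suc a"]
      \<comment> \<open>Only the recursion with base \<open>Zero\<close> is unfolded, so
        \<open>?add\<close> stays intact for the fact \<open>add\<close>.\<close>
      by (simp del: rec_eval.simps(5) add: rec_eval.simps(5)[of Zero])
  qed simp
  note sum = total_recursive_comp2[OF add]
  show ?thesis
    unfolding prod_encode_def prod.case
    by (intro sum assms total_recursive_comp1[OF tri])
qed

text \<open>Each round decrements \<open>r\<close> and restores it, so execution alternates between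
  two configurations.\<close>

lemma diverging_loop:
  assumes "s r \<noteq> 0"
  shows "fst ((step ^^ n) ([Loop r [Inc r]], s)) \<noteq> []"
proof -
  have "(step ^^ n) ([Loop r [Inc r]], s) \<in>
      {([Loop r [Inc r]], s), ([Inc r, Loop r [Inc r]], s(r := s r - 1))}"
    using assms by (induction n) (auto simp: fun_upd_idem)
  then show ?thesis by auto
qed

lemma fst_funpow_step_Nil: "(step ^^ n) ([], s) = ([], s)"
  by (induction n) simp_all

section \<open>Self-reference\<close>

text \<open>
  The list \<open>xs\<close> plays two roles: its entries are the parts of the presentation (see \<open>self_data\<close>),
  and the first six entries of the vector \<open>v\<close> that labels the transitions from the initial state;
  the last entry is the code of the rest of this vector.
\<close>

definition presentation_code :: "nat list \<Rightarrow> nat" where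
  "presentation_code xs = (let i = to_nat (None :: control);
      v = Suc (prod_encode (xs ! 0, Suc (prod_encode (xs ! 1, Suc (prod_encode (xs ! 2,
          Suc (prod_encode (xs ! 3, Suc (prod_encode (xs ! 4, Suc (prod_encode (xs ! 5, xs ! 5))))))))))))
    in list_encode [xs ! 0, xs ! 1, list_encode [0, 1], i,
      Suc (prod_encode (list_encode [i, 0, v, xs ! 2],
        Suc (prod_encode (list_encode [i, 1, v, xs ! 2], xs ! 3)))),
      xs ! 1, xs ! 4])"

lemma total_recursive_presentation_code: "total_recursive 6 presentation_code"
  unfolding presentation_code_def[abs_def] Let_def list_encode.simps
  by (intro total_recursive_Suc total_recursive_prod_encode total_recursive_const
      total_recursive_nth) simp_all

text \<open>Not circular: transitions from running controls are listed with \<open>[]\<close> for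
  the data, which their labels do not use, and \<open>presentation_code\<close> rebuilds the label
  of the initial transitions from the entries.\<close>

definition self_data :: "nat \<Rightarrow> instr list list \<Rightarrow> instr list \<Rightarrow> nat list" where
  "self_data R ps p = [3 * R + 2,
     list_encode (map to_nat (None # running_controls R ps)),
     to_nat (Some (None, p) :: control),
     list_encode (map code_trans (edges R p [] (running_controls R ps))),
     list_encode (map code_gen (bad_gens R)),
     list_encode (map (\<lambda>j. of_bool (j = 3 * R)) [6..<3 * R + 2])]"

text \<open>The fixed point: a program that finds these six numbers in its registers can compute the
  code of its own automaton.\<close>

lemma code_PA_self_data:
  assumes "R \<ge> 6"
  shows "code_PA (program_presentation R ps p (self_data R ps p)) = presentation_code (self_data R ps p)"
proof -
  let ?xs = "self_data R ps p"
  have data: "?xs ! 0 = 3 * R + 2" "?xs ! 1 = list_encode (map to_nat (None # running_controls R ps))"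
    "?xs ! 2 = to_nat (Some (None, p) :: control)"
    "?xs ! 3 = list_encode (map code_trans (edges R p [] (running_controls R ps)))"
    "?xs ! 4 = list_encode (map code_gen (bad_gens R))"
    unfolding self_data_def by simp_all
  have len: "length ?xs = 6" by (simp add: self_data_def)
  have "vec (3 * R + 2) (weight R ?xs None a) = ?xs @ map (\<lambda>j. of_bool (j = 3 * R)) [6..<3 * R + 2]" for a
    using assms by (intro nth_equalityI) (auto simp: len nth_append)
  then have label: "list_encode (vec (3 * R + 2) (weight R ?xs None a)) =
      Suc (prod_encode (?xs ! 0, Suc (prod_encode (?xs ! 1, Suc (prod_encode (?xs ! 2,
          Suc (prod_encode (?xs ! 3, Suc (prod_encode (?xs ! 4, Suc (prod_encode (?xs ! 5, ?xs ! 5))))))))))))" for a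
    by (simp add: self_data_def)
  have "weight R ?xs (Some s) a = weight R [] (Some s) a" for s a
    by (rule ext, cases s) simp
  then have "edge R p ?xs (Some s) a = edge R p [] (Some s) a" for s a
    by (simp add: edge_def)
  then have edges: "edges R p ?xs (running_controls R ps) = edges R p [] (running_controls R ps)"
    unfolding edges_def running_controls_def by (simp add: comp_def del: List.product.simps)
  have "edges R p ?xs (None # running_controls R ps) =
     edge R p ?xs None 0 # edge R p ?xs None 1 # edges R p [] (running_controls R ps)"
    using edges by (simp add: edges_def)
  then show ?thesis
    unfolding code_PA_def program_presentation_def presentation_code_def Let_def
    by (simp only: presentation.simps list.map edge_def code_trans.simps next_control.simps
        list_encode.simps label data)
qed

text \<open>The program asks the assumed decider about its own automaton and halts iff the answer is
  0, whereas halting means universality.\<close>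

lemma universality_undecidable:
  assumes acc: "acc = reach_reg_accepting \<or> acc = weak_reset_accepting"
  shows "\<not> decidable_on code_PA deterministic_PAs (\<lambda>D. universal acc (automaton_of D))"
proof
  assume "decidable_on code_PA deterministic_PAs (\<lambda>D. universal acc (automaton_of D))"
  then obtain f where f: "\<And>D. D \<in> deterministic_PAs \<Longrightarrow>
      rec_eval f [code_PA D] = Some (if universal acc (automaton_of D) then 1 else 0)"
    unfolding decidable_on_def by blast
  obtain k where k: "\<And>xs. length xs = 6 \<Longrightarrow> rec_eval k xs = Some (presentation_code xs)"
    using total_recursive_presentation_code unfolding total_recursive_def by blast
  obtain q where q: "implements q (Comp f [k]) [0..<6] 6 7"
    using compilableD[OF all_compilable, of "[0..<6]" 7 6] by auto
  \<comment> \<open>The last loop diverges iff the answer in register 6 is nonzero. As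
    \<open>p\<close> does not contain the data, \<open>ps\<close>, \<open>R\<close> and
    \<open>xs\<close> can be chosen from it afterwards.\<close>
  define p where "p = q @ [Loop 6 [Inc 6]]"
  obtain Q where Q: "finite Q" "p \<in> Q" "\<forall>x\<in>Q. \<forall>a. next_code x a \<in> Q"
    using finite_code_closure by blast
  obtain ps where ps: "set ps = Q" using finite_list[OF Q(1)] ..
  \<comment> \<open>Large enough for the registers of all codes in \<open>Q\<close> and for the six
    loaded numbers.\<close>
  define R where "R = 6 + Suc (Max (head_reg ` Q))"
  have "6 \<le> R" by (simp add: R_def)
  have head: "head_reg cs < R" if "cs \<in> Q" for cs
  proof -
    have "head_reg cs \<le> Max (head_reg ` Q)" using Q(1) that by simp
    then show ?thesis by (simp add: R_def)
  qed
  define xs where "xs = self_data R ps p"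
  have len: "length xs = 6" by (simp add: xs_def self_data_def)
  interpret program_automaton R ps p xs
    using Q head by unfold_locales (auto simp: ps len R_def)
  define y where "y = (if universal acc A then 1 else 0 :: nat)"
  have "rec_eval f [presentation_code xs] = Some y"
    using f[OF deterministic_PA] code_PA_self_data[of R ps p] \<open>6 \<le> R\<close>
    unfolding y_def A_def unfolding xs_def by simp
  moreover have "map (load xs) [0..<6] = xs"
    by (intro nth_equalityI) (auto simp: len load_def)
  ultimately have "runs q (load xs) ((load xs)(6 := y))"
    using len k by (intro implementsD[OF q]) (auto simp: load_def)
  then obtain n where n: "conf n = ([Loop 6 [Inc 6]], (load xs)(6 := y))"
    unfolding conf_def unfolding runs_def p_def by blast
  have "y = 0 \<longleftrightarrow> (\<exists>m. fst (conf m) = [])"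
  proof
    assume "y = 0"
    then have "fst (conf (Suc n)) = []" using n by (simp add: conf_def)
    then show "\<exists>m. fst (conf m) = []" ..
  next
    assume "\<exists>m. fst (conf m) = []"
    then obtain m s where m: "conf m = ([], s)" by (metis prod.collapse)
    \<comment> \<open>The same configuration is reached from the halted one and from the final
      loop.\<close>
    have "conf (m + n) = ([], s)"
      using m fst_funpow_step_Nil[of n s] by (simp add: conf_def funpow_add add.commute[of m])
    moreover have "conf (m + n) = (step ^^ m) ([Loop 6 [Inc 6]], (load xs)(6 := y))"
      using n by (simp add: conf_def funpow_add)
    ultimately show "y = 0" using diverging_loop[of "(load xs)(6 := y)" 6 m] by auto
  qed
  then show False using universal_iff_halts[OF acc] by (simp add: y_def split: if_splits)
qed

theorem lemma26:
  shows "\<not> decidable_on code_PA deterministic_PAs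
           (\<lambda>D. universal reach_reg_accepting (automaton_of D)) \<and>
         \<not> decidable_on code_PA deterministic_PAs
           (\<lambda>D. universal weak_reset_accepting (automaton_of D))"
  by (simp add: universality_undecidable)

end
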